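(* For every integer $r\ge0$ and every integer $n\ge0$, \[ B^{(r)}_{n,\lambda}(x)=\sum_{k=0}^{n}(1)_{k,\lambda}\Big(\frac{x}{1+\lambda x}\Big)^k{n+r\brace k+r}_{r,\lambda}. \]
   Context: Let $\lambda$ be a fixed nonzero real number and $r\ge0$ an integer. The degenerate falling factorial is $(x)_{0,\lambda}=1$ and $(x)_{n,\lambda}=x(x-\lambda)\cdots(x-(n-1)\lambda)$ for $n\ge1$. The degenerate exponential is $e_\lambda^{x}(t)=(1+\lambda t)^{x/\lambda}=\sum_{n\ge0}(x)_{n,\lambda}\frac{t^n}{n!}$, and $e_\lambda(t)=e_\lambda^1(t)$. The degenerate $r$-Stirling numbers of the second kind are defined by $\frac{1}{k!}(e_\lambda(t)-1)^k e_\lambda^{r}(t)=\sum_{n\ge k}{n+r\brace k+r}_{r,\lambda}\frac{t^n}{n!}$ for $k\ge0$. For real $x$ with $1+\lambda x>0$, the fully degenerate $r$-Bell polynomials are defined by the formal power series identity in $t$ \[ \frac{1}{e_\lambda(x)}\,e_\lambda\big(xe_\lambda(t)\big)\,e_\lambda^{r}(t)=\sum_{n\ge0}B^{(r)}_{n,\lambda}(x)\frac{t^n}{n!}, \] where $e_\lambda(x)=(1+\lambda x)^{1/\lambda}$ and $e_\lambda(xe_\lambda(t))=(1+\lambda xe_\lambda(t))^{1/\lambda}$. *)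

theory Defs
  imports Complex_Main "HOL-Computational_Algebra.Formal_Power_Series"
begin

definition deg_ffact :: "real \<Rightarrow> real \<Rightarrow> nat \<Rightarrow> real" where
  "deg_ffact lam x n = (\<Prod>i<n. x - real i * lam)"

(* F^a for a real exponent a and a series F with positive constant term c: write F = c (1 + G)
   with G of zero constant term; then F^a = c^a (1 + G)^a, where (1 + G)^a is Newton's binomial
   series with G substituted. Only meaningful for fps_nth F 0 > 0; the lemma fps_deriv_fps_powr
   gives the differential equation that, with the constant term, characterises F^a. *)
definition fps_powr :: "real fps \<Rightarrow> real \<Rightarrow> real fps" where
  "fps_powr F a =
     fps_const (fps_nth F 0 powr a) *
     (fps_binomial a oo (fps_const (inverse (fps_nth F 0)) * F - 1))"

(* e_lam^x(F) = (1 + lam F)^(x / lam), with a formal power series F as argument; F = fps_X gives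
   e_lam^x(t). Requires 1 + lam * fps_nth F 0 > 0. *)
definition deg_exp_fps :: "real \<Rightarrow> real \<Rightarrow> real fps \<Rightarrow> real fps" where
  "deg_exp_fps lam x F = fps_powr (1 + fps_const lam * F) (x / lam)"

(* e_lam^x(y) for a real number y with 1 + lam * y > 0 *)
definition deg_exp :: "real \<Rightarrow> real \<Rightarrow> real \<Rightarrow> real" where
  "deg_exp lam x y = (1 + lam * y) powr (x / lam)"

(* The indices are the unshifted ones: deg_r_Stirling2 lam r n k is the number written
   {n+r brace k+r}_{r,lam}. It vanishes for n < k, since e_lam(t) - 1 has no constant term. *)
definition deg_r_Stirling2 :: "real \<Rightarrow> nat \<Rightarrow> nat \<Rightarrow> nat \<Rightarrow> real" where
  "deg_r_Stirling2 lam r n k =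
     fact n * fps_nth (fps_const (1 / fact k) * (deg_exp_fps lam 1 fps_X - 1) ^ k *
                       deg_exp_fps lam (real r) fps_X) n"

definition fully_deg_r_Bell :: "real \<Rightarrow> nat \<Rightarrow> nat \<Rightarrow> real \<Rightarrow> real" where
  "fully_deg_r_Bell lam r n x =
     fact n * fps_nth (fps_const (1 / deg_exp lam 1 x) *
                       deg_exp_fps lam 1 (fps_const x * deg_exp_fps lam 1 fps_X) *
                       deg_exp_fps lam (real r) fps_X) n"

lemma fps_powr_nth_0:
  "fps_nth (fps_powr F a) 0 = fps_nth F 0 powr a"
  by (simp add: fps_powr_def)

lemma fps_deriv_fps_powr:
  assumes "fps_nth F 0 > 0"
  shows "F * fps_deriv (fps_powr F a) = fps_const a * fps_deriv F * fps_powr F a"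
proof -
  define c where "c = fps_nth F 0"
  define G where "G = fps_const (inverse c) * F - 1"
  have c: "c > 0" using assms by (simp add: c_def)
  have G0: "fps_nth G 0 = 0" using c by (simp add: G_def c_def)
  have F: "F = fps_const c * (1 + G)"
    using c by (simp add: G_def fps_const_mult [symmetric] mult.assoc [symmetric] del: fps_const_mult)
       (simp add: fps_const_mult)
  have dF: "fps_deriv F = fps_const c * fps_deriv G" by (subst F) simp
  have "(1 + fps_X) * fps_deriv (fps_binomial a) = fps_const a * fps_binomial a"
    by (subst fps_binomial_deriv) (simp add: fps_divide_unit mult.left_commute inverse_mult_eq_1')
  then have "((1 + fps_X) * fps_deriv (fps_binomial a)) oo G = (fps_const a * fps_binomial a) oo G"
    by simp
  then have *: "(1 + G) * (fps_deriv (fps_binomial a) oo G) = fps_const a * (fps_binomial a oo G)"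
    using G0 by (simp add: fps_compose_mult_distrib fps_compose_add_distrib)
  have P: "fps_powr F a = fps_const (c powr a) * (fps_binomial a oo G)"
    by (simp add: fps_powr_def G_def c_def)
  have "F * fps_deriv (fps_powr F a) = fps_const c * fps_const (c powr a) * fps_deriv G *
          ((1 + G) * (fps_deriv (fps_binomial a) oo G))"
    unfolding P by (subst F) (simp add: fps_compose_deriv [OF G0] mult_ac del: fps_const_mult)
  also have "\<dots> = fps_const a * fps_deriv F * fps_powr F a"
    unfolding * P dF by (simp only: mult_ac)
  finally show ?thesis .
qed

lemma deg_exp_fps_X:
  assumes "lam \<noteq> 0"
  shows "deg_exp_fps lam x fps_X = Abs_fps (\<lambda>n. deg_ffact lam x n / fact n)"
proof -
  have "deg_exp_fps lam x fps_X = fps_binomial (x / lam) oo (fps_const lam * fps_X)"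
    by (simp add: deg_exp_fps_def fps_powr_def)
  also have "\<dots> = Abs_fps (\<lambda>n. lam ^ n * (x / lam gchoose n))"
    by (simp add: fps_compose_linear fps_eq_iff)
  also have "\<dots> = Abs_fps (\<lambda>n. deg_ffact lam x n / fact n)"
  proof -
    have "lam ^ n * (\<Prod>i<n. x / lam - real i) = (\<Prod>i<n. x - real i * lam)" for n
      using assms by (induction n) (simp_all add: field_simps)
    then show ?thesis
      by (simp add: fps_eq_iff gbinomial_prod_rev deg_ffact_def atLeast0LessThan)
  qed
  finally show ?thesis .
qed

end

theory Submission
  imports Defs
begin

text \<open>
  Put \<open>E = e\<^sub>\<lambda>(t)\<close> and \<open>c = 1 + \<lambda>x\<close>. Since \<open>1 + \<lambda>xE = c (1 + (\<lambda>x/c) (E - 1))\<close>, Newton's binomial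
  series in powers of \<open>E - 1\<close> has coefficients \<open>(1/\<lambda> gchoose k) (\<lambda>x/c)\<^sup>k = ((1)\<^sub>k\<^sub>,\<^sub>\<lambda> / k!) (x/c)\<^sup>k\<close>.
\<close>

text \<open>Since \<open>b\<close> has no constant term, \<open>b ^ k\<close> has no coefficients
  below degree \<open>k\<close>, so every coefficient of \<open>a oo b\<close> up to degree
  \<open>n\<close> can be summed over the common range \<open>0..n\<close>; the sum over
  \<open>k\<close> then moves outside the convolution with \<open>c\<close>.\<close>

lemma fps_compose_mult_nth:
  fixes a b c :: "'a :: comm_ring_1 fps"
  assumes "fps_nth b 0 = 0"
  shows "fps_nth ((a oo b) * c) n = (\<Sum>k=0..n. fps_nth a k * fps_nth (b ^ k * c) n)"
proof -
  have "fps_nth (a oo b) j = (\<Sum>k=0..n. fps_nth a k * fps_nth (b ^ k) j)" if "j \<le> n" for j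
    unfolding fps_compose_nth
    using that by (intro sum.mono_neutral_left)
      (auto simp: startsby_zero_power_prefix [OF assms])
  then have "fps_nth ((a oo b) * c) n =
      (\<Sum>j=0..n. \<Sum>k=0..n. fps_nth a k * fps_nth (b ^ k) j * fps_nth c (n - j))"
    by (simp add: fps_mult_nth sum_distrib_right)
  also have "\<dots> = (\<Sum>k=0..n. fps_nth a k * fps_nth (b ^ k * c) n)"
    by (subst sum.swap) (simp add: fps_mult_nth sum_distrib_left mult.assoc)
  finally show ?thesis .
qed

text \<open>Each of the \<open>k\<close> factors of the falling product absorbs one
  \<open>lam\<close>.\<close>

lemma gchoose_times_power_deg_ffact:
  assumes "lam \<noteq> 0"
  shows "(x / lam gchoose k) * lam ^ k = deg_ffact lam x k / fact k"
proof -
  have "(\<Prod>i<k. x / lam - real i) * lam ^ k = (\<Prod>i<k. x - real i * lam)"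
    using assms by (induction k) (simp_all add: field_simps)
  then show ?thesis
    by (simp add: gbinomial_prod_rev deg_ffact_def atLeast0LessThan)
qed

text \<open>\<open>fps_powr\<close> divides by the constant term of its base, which is
  \<open>1 + lam * x\<close> because \<open>E\<close> starts with 1; so Newton's series comes out in
  powers of \<open>E - 1\<close>.\<close>

lemma deg_exp_fps_scaled:
  fixes lam x :: real
  assumes "1 + lam * x > 0" and E0: "fps_nth E 0 = 1"
  shows "deg_exp_fps lam y (fps_const x * E) =
    fps_const (deg_exp lam y x) *
      (fps_binomial (y / lam) oo (fps_const (lam * x / (1 + lam * x)) * (E - 1)))"
proof -
  have "fps_const (inverse (1 + lam * x)) * (1 + fps_const lam * (fps_const x * E)) - 1 =
      fps_const (lam * x / (1 + lam * x)) * (E - 1)"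
    (is "?l = ?r")
  proof (rule fps_ext)
    fix n
    show "fps_nth ?l n = fps_nth ?r n"
      using assms
      by (cases "n = 0") (simp_all add: field_simps)
  qed
  then show ?thesis
    using E0 by (simp add: deg_exp_fps_def fps_powr_def deg_exp_def)
qed

theorem theorem2p9:
  fixes lam x :: real and r n :: nat
  assumes "lam \<noteq> 0" and "1 + lam * x > 0"
  shows "fully_deg_r_Bell lam r n x =
           (\<Sum>k=0..n. deg_ffact lam 1 k * (x / (1 + lam * x)) ^ k * deg_r_Stirling2 lam r n k)"
proof -
  define E where "E = deg_exp_fps lam 1 fps_X"
  define R where "R = deg_exp_fps lam (real r) fps_X"
  define q where "q = x / (1 + lam * x)"
  define G where "G = fps_const (lam * q) * (E - 1)"
  have E0: "fps_nth E 0 = 1"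
    by (simp add: E_def deg_exp_fps_X [OF assms(1)] deg_ffact_def)
  have pos: "deg_exp lam 1 x > 0"
    using assms(2) by (simp add: deg_exp_def)
  \<comment> \<open>The prefactor cancels the constant that \<open>deg_exp_fps_scaled\<close> pulls
    out.\<close>
  have "fps_const (1 / deg_exp lam 1 x) * deg_exp_fps lam 1 (fps_const x * E) * R =
      (fps_binomial (1 / lam) oo G) * R"
    using pos by (simp add: deg_exp_fps_scaled [OF assms(2) E0] G_def q_def
        mult.assoc [symmetric])
  then have "fully_deg_r_Bell lam r n x = fact n * fps_nth ((fps_binomial (1 / lam) oo G) * R) n"
    by (simp only: fully_deg_r_Bell_def E_def R_def)
  also have "\<dots> = fact n * (\<Sum>k=0..n. (1 / lam gchoose k) * fps_nth (G ^ k * R) n)"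
    by (subst fps_compose_mult_nth) (simp_all add: G_def E0)
  also have "\<dots> = (\<Sum>k=0..n. deg_ffact lam 1 k * q ^ k * deg_r_Stirling2 lam r n k)"
    unfolding sum_distrib_left
  proof (rule sum.cong [OF refl])
    fix k
    have "fps_nth (G ^ k * R) n = lam ^ k * q ^ k * fps_nth ((E - 1) ^ k * R) n"
      by (simp add: G_def power_mult_distrib fps_const_power mult.assoc del: fps_const_mult)
    \<comment> \<open>The \<open>lam ^ k\<close> from \<open>G\<close> is moved next to the binomial
      coefficient; together they give \<open>deg_ffact lam 1 k / fact k\<close>, whose
      \<open>1 / fact k\<close> is the one in \<open>deg_r_Stirling2\<close>.\<close>
    then have "(1 / lam gchoose k) * fps_nth (G ^ k * R) n =
        ((1 / lam gchoose k) * lam ^ k) * q ^ k * fps_nth ((E - 1) ^ k * R) n"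
      by (simp only: mult.assoc)
    then show "fact n * ((1 / lam gchoose k) * fps_nth (G ^ k * R) n) =
        deg_ffact lam 1 k * q ^ k * deg_r_Stirling2 lam r n k"
      unfolding gchoose_times_power_deg_ffact [OF assms(1)]
      by (simp add: deg_r_Stirling2_def E_def R_def mult.assoc)
  qed
  finally show ?thesis
    by (simp add: q_def)
qed

end
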